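(* Let $p,K$ be positive integers, let $S^1,\dots,S^K\in\mathbb{S}^p$ be sample covariance matrices (so each $S^k$ is symmetric positive semidefinite), and let $\mu_1,\mu_2>0$. Consider the problem $$\min_{\Theta=(\Theta^1,\dots,\Theta^K)\in(\mathbb{S}^p)^K}\ \sum_{k=1}^K\big(h(\Theta^k)+\langle S^k,\Theta^k\rangle\big)+\mu_1\sum_{i\neq j}\sum_{k=1}^K|\Theta^k_{ij}|+\mu_2\sum_{i\neq j}\sum_{k<k'}|\Theta^k_{ij}-\Theta^{k'}_{ij}|,$$ where $h(A)=-\log\det A$ if $A\in\mathbb{S}^p_{++}$ and $h(A)=+\infty$ otherwise, and assume that it has an optimal solution. Let $C_1,\dots,C_T$ be pairwise disjoint sets with $\bigcup_{t=1}^T C_t=\{1,\dots,p\}$. Then the problem has an optimal solution $\hat\Theta=(\hat\Theta^1,\dots,\hat\Theta^K)$ that is block diagonal with blocks $C_1,\dots,C_T$ if and only if $$\Big|\sum_{k\in\mathcal{A}}S^k_{ij}\Big|\le|\mathcal{A}|\,\mu_1+|\mathcal{A}|\,(K-|\mathcal{A}|)\,\mu_2$$ for all nonempty subsets $\mathcal{A}\subseteq\{1,\dots,K\}$ and all $i\in C_t$, $j\in C_{t'}$ with $t\neq t'$.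
   Context: $\mathbb{S}^p$ is the space of real symmetric $p\times p$ matrices, $\mathbb{S}^p_{++}$ the set of positive definite ones, $\langle\cdot,\cdot\rangle$ the trace inner product, and $|\mathcal{A}|$ the cardinality of $\mathcal{A}$. Sums over $i\neq j$ run over all ordered pairs $(i,j)\in\{1,\dots,p\}^2$ with $i\ne j$. A tuple $\hat\Theta=(\hat\Theta^1,\dots,\hat\Theta^K)$ is called block diagonal with blocks $C_1,\dots,C_T$ if, after a common permutation of the indices that groups the elements of each $C_t$ together, every $\hat\Theta^k$ is block diagonal with diagonal blocks indexed by $C_1,\dots,C_T$; equivalently, $\hat\Theta^k_{ij}=0$ for every $k$ whenever $i\in C_t$, $j\in C_{t'}$, $t\ne t'$. *)

theory Defs
  imports "HOL-Analysis.Analysis"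
begin

definition sym_mat :: "real^'p^'p \<Rightarrow> bool" where
  "sym_mat A \<longleftrightarrow> transpose A = A"

definition psd_mat :: "real^'p^'p \<Rightarrow> bool" where
  "psd_mat A \<longleftrightarrow> sym_mat A \<and> (\<forall>x. x \<bullet> (A *v x) \<ge> 0)"

definition pd_mat :: "real^'p^'p \<Rightarrow> bool" where
  "pd_mat A \<longleftrightarrow> sym_mat A \<and> (\<forall>x. x \<noteq> 0 \<longrightarrow> x \<bullet> (A *v x) > 0)"

definition trace_inner :: "real^'p^'p \<Rightarrow> real^'p^'p \<Rightarrow> real" where
  "trace_inner A B = trace (transpose A ** B)"

definition neg_logdet :: "real^'p^'p \<Rightarrow> ereal" where
  "neg_logdet A = (if pd_mat A then ereal (- ln (det A)) else \<infinity>)"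

text \<open>
  A \<open>K\<close>-tuple of matrices is a function on \<open>nat\<close> of which only the values at \<open>1, \<dots>, K\<close>
  are ever used.
\<close>

definition objective ::
  "nat \<Rightarrow> (nat \<Rightarrow> real^'p^'p) \<Rightarrow> real \<Rightarrow> real \<Rightarrow> (nat \<Rightarrow> real^'p^'p) \<Rightarrow> ereal" where
  "objective K S \<mu>1 \<mu>2 \<Theta> =
     (\<Sum>k=1..K. neg_logdet (\<Theta> k) + ereal (trace_inner (S k) (\<Theta> k)))
     + ereal (\<mu>1 * (\<Sum>(i, j) | i \<noteq> j. \<Sum>k=1..K. \<bar>\<Theta> k $ i $ j\<bar>))
     + ereal (\<mu>2 * (\<Sum>(i, j) | i \<noteq> j. \<Sum>(k, k') | 1 \<le> k \<and> k < k' \<and> k' \<le> K.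
                \<bar>\<Theta> k $ i $ j - \<Theta> k' $ i $ j\<bar>))"

definition optimal_solution ::
  "nat \<Rightarrow> (nat \<Rightarrow> real^'p^'p) \<Rightarrow> real \<Rightarrow> real \<Rightarrow> (nat \<Rightarrow> real^'p^'p) \<Rightarrow> bool" where
  "optimal_solution K S \<mu>1 \<mu>2 \<Theta> \<longleftrightarrow>
     is_arg_min (objective K S \<mu>1 \<mu>2) (\<lambda>\<Theta>. \<forall>k\<in>{1..K}. sym_mat (\<Theta> k)) \<Theta>"

text \<open>
  Block diagonality is stated entrywise: the index type \<open>'p\<close> carries no order, so no explicit
  permutation of the indices is needed.
\<close>

definition block_diagonal ::
  "nat \<Rightarrow> nat \<Rightarrow> (nat \<Rightarrow> 'p set) \<Rightarrow> (nat \<Rightarrow> real^'p^'p) \<Rightarrow> bool" where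
  "block_diagonal K T C \<Theta> \<longleftrightarrow>
     (\<forall>t\<in>{1..T}. \<forall>t'\<in>{1..T}. t \<noteq> t' \<longrightarrow>
        (\<forall>i\<in>C t. \<forall>j\<in>C t'. \<forall>k\<in>{1..K}. \<Theta> k $ i $ j = 0))"

end

theory Submission
  imports Defs
begin

text \<open>
  The off-diagonal part of the objective splits over ordered pairs of indices \<open>(i, j)\<close> into
  \<open>\<phi>(s, x) = \<Sum> s k * x k + \<mu>1 * \<Sum> \<bar>x k\<bar> + \<mu>2 * \<Sum> \<bar>x k - x k'\<bar>\<close> with \<open>s k = S k $ i $ j\<close>. As \<open>\<phi>\<close> is additive
  along the level sets of \<open>x\<close>, the inequalities of the theorem say exactly that \<open>\<phi>(s, x) \<ge> 0\<close> for
  all \<open>x\<close>. If they hold, then setting the entries between a block and its complement to zero does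
  not increase the objective, since by Fischer's inequality this does not decrease the
  determinant. Conversely, at a block diagonal optimum the determinant is even, hence stationary,
  in the direction of a pair of entries outside the blocks, so that the one-sided derivative of
  the objective there is \<open>2 * \<phi>(s, x)\<close>, which must be nonnegative.
\<close>

subsection \<open>Simultaneous diagonalisation of symmetric matrices\<close>

lemma sym_mat_inner:
  fixes A :: "real^'p^'p"
  assumes "sym_mat A"
  shows "x \<bullet> (A *v y) = y \<bullet> (A *v x)"
proof -
  have "x \<bullet> (A *v y) = (x v* A) \<bullet> y" by (simp add: dot_lmul_matrix)
  also have "x v* A = A *v x"
    using assms transpose_matrix_vector[of A x] by (simp add: sym_mat_def)
  finally show ?thesis by (simp add: inner_commute)
qed

lemma continuous_on_quadratic_form [continuous_intros]:
  fixes A :: "real^'p^'p"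
  shows "continuous_on X (\<lambda>x. x \<bullet> (A *v x))"
  by (intro continuous_intros linear_continuous_on linear_linear[THEN iffD1]) auto

text \<open>Compactness of the unit sphere gives a positive minimum of the form there, and
  homogeneity of degree two carries the bound to all vectors.\<close>

lemma pd_mat_quadratic_lower_bound:
  fixes A :: "real^'p^'p"
  assumes "pd_mat A"
  obtains c where "c > 0" "\<And>x. c * (norm x)\<^sup>2 \<le> x \<bullet> (A *v x)"
proof -
  have "sphere (0::real^'p) 1 \<noteq> {}" by simp
  then obtain u where u: "u \<in> sphere 0 1" "\<And>x. x \<in> sphere 0 1 \<Longrightarrow> u \<bullet> (A *v u) \<le> x \<bullet> (A *v x)"
    using continuous_attains_inf[OF compact_sphere _ continuous_on_quadratic_form[of "sphere 0 1" A]]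
    by blast
  define c where "c = u \<bullet> (A *v u)"
  have "u \<noteq> 0" using u(1) by auto
  then have "c > 0" using assms by (simp add: c_def pd_mat_def)
  moreover have "c * (norm x)\<^sup>2 \<le> x \<bullet> (A *v x)" for x
  proof (cases "x = 0")
    case False
    define y where "y = x /\<^sub>R norm x"
    have x: "x = norm x *\<^sub>R y" using False by (simp add: y_def)
    have "c \<le> y \<bullet> (A *v y)" using u(2)[of y] False by (simp add: c_def y_def)
    then have "c * (norm x)\<^sup>2 \<le> (norm x)\<^sup>2 * (y \<bullet> (A *v y))"
      by (simp add: mult.commute[of c] mult_left_mono)
    also have "\<dots> = (norm x *\<^sub>R y) \<bullet> (A *v (norm x *\<^sub>R y))"
      by (simp add: matrix_vector_mult_scaleR power2_eq_square)
    also have "\<dots> = x \<bullet> (A *v x)" using x by simp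
    finally show ?thesis .
  qed simp
  ultimately show ?thesis using that by blast
qed

lemma nonpos_quadratic_imp_linear_zero:
  fixes b c :: real
  assumes "\<And>t. 2 * t * b + t\<^sup>2 * c \<le> 0"
  shows "b = 0"
proof (rule ccontr)
  assume "b \<noteq> 0"
  \<comment> \<open>Large enough that \<open>2 * d + c > 0\<close>, so at \<open>t = b / d\<close>
    the linear term outweighs the quadratic one.\<close>
  define d where "d = \<bar>c\<bar> + 1"
  have d: "d > 0" "- d < c" by (auto simp: d_def)
  have "2 * (b / d) * b + (b / d)\<^sup>2 * c = b\<^sup>2 / d\<^sup>2 * (2 * d + c)"
    using d by (simp add: field_simps power2_eq_square)
  moreover have "b\<^sup>2 / d\<^sup>2 * (2 * d + c) > 0"
    using d \<open>b \<noteq> 0\<close> by (intro mult_pos_pos) auto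
  ultimately show False using assms[of "b / d"] by linarith
qed

text \<open>Induction step of the spectral theorem for the pencil of \<open>E\<close> and
  \<open>A\<close>: a maximiser of \<open>x \<bullet> (E *v x)\<close> over A-unit vectors that are
  A-orthogonal to \<open>W\<close> is a further generalised eigenvector.\<close>

lemma generalised_eigenvector_exists:
  fixes A E :: "real^'p^'p"
  assumes A: "pd_mat A" and E: "sym_mat E"
    and W: "finite W" "card W < CARD('p)"
    and one: "\<And>w. w \<in> W \<Longrightarrow> w \<bullet> (A *v w) = 1"
    and orth: "\<And>w w'. w \<in> W \<Longrightarrow> w' \<in> W \<Longrightarrow> w \<noteq> w' \<Longrightarrow> w \<bullet> (A *v w') = 0"
    and eig: "\<And>w. w \<in> W \<Longrightarrow> \<exists>e. E *v w = e *\<^sub>R (A *v w)"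
  obtains v where "v \<bullet> (A *v v) = 1" "\<And>w. w \<in> W \<Longrightarrow> v \<bullet> (A *v w) = 0"
    "\<exists>e. E *v v = e *\<^sub>R (A *v v)"
proof -
  have symA: "sym_mat A" using A by (simp add: pd_mat_def)
  note cA = sym_mat_inner[OF symA] and cE = sym_mat_inner[OF E]
  define V where "V = {x. \<forall>w\<in>W. x \<bullet> (A *v w) = 0}"
  define X where "X = V \<inter> {x. x \<bullet> (A *v x) = 1}"
  \<comment> \<open>Fewer than \<open>CARD('p)\<close> vectors leave a nonzero vector orthogonal to
    all of them, so the constraint space \<open>V\<close> is not trivial.\<close>
  have "dim ((\<lambda>w. A *v w) ` W) < DIM(real^'p)"
    using dim_le_card'[of "(\<lambda>w. A *v w) ` W"] card_image_le[OF W(1), of "\<lambda>w. A *v w"] W by simp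
  then obtain x0 where "x0 \<noteq> 0" "\<And>y. y \<in> span ((\<lambda>w. A *v w) ` W) \<Longrightarrow> orthogonal x0 y"
    using orthogonal_to_subspace_exists by blast
  then have x0: "x0 \<noteq> 0" "x0 \<in> V"
    by (auto simp: V_def orthogonal_def intro: span_base)
  have q0: "x0 \<bullet> (A *v x0) > 0" using A x0 by (simp add: pd_mat_def)
  obtain c where c: "c > 0" "\<And>x. c * (norm x)\<^sup>2 \<le> x \<bullet> (A *v x)"
    using pd_mat_quadratic_lower_bound[OF A] by blast
  have "bounded X"
  proof (rule boundedI)
    fix x assume "x \<in> X"
    then have "c * (norm x)\<^sup>2 \<le> 1" using c(2)[of x] by (simp add: X_def)
    then have "(norm x)\<^sup>2 \<le> 1 / c" using c by (simp add: field_simps)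
    then show "norm x \<le> sqrt (1 / c)" by (rule real_le_rsqrt)
  qed
  moreover have "closed X"
  proof -
    have "V = (\<Inter>w\<in>W. {x. x \<bullet> (A *v w) = 0})" by (auto simp: V_def)
    moreover have "closed (\<Inter>w\<in>W. {x. x \<bullet> (A *v w) = 0})"
      by (intro closed_INT ballI closed_Collect_eq continuous_intros)
    moreover have "closed {x. x \<bullet> (A *v x) = 1}"
      by (intro closed_Collect_eq continuous_intros)
    ultimately show ?thesis by (auto simp: X_def)
  qed
  ultimately have "compact X" by (simp add: compact_eq_bounded_closed)
  moreover have norm1: "(x /\<^sub>R sqrt (x \<bullet> (A *v x))) \<in> X" if "x \<in> V" "x \<bullet> (A *v x) > 0" for x
    using that by (auto simp: X_def V_def matrix_vector_mult_scaleR field_simps)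
  then have "X \<noteq> {}" using x0 q0 by blast
  ultimately obtain v where v: "v \<in> X" "\<And>x. x \<in> X \<Longrightarrow> x \<bullet> (E *v x) \<le> v \<bullet> (E *v v)"
    using continuous_attains_sup[OF _ _ continuous_on_quadratic_form[of X E]] by blast
  define l where "l = v \<bullet> (E *v v)"
  have vV: "v \<in> V" and v1: "v \<bullet> (A *v v) = 1" using v(1) by (auto simp: X_def)
  have ray: "x \<bullet> (E *v x) \<le> l * (x \<bullet> (A *v x))" if "x \<in> V" for x
  proof (cases "x = 0")
    case False
    define q where "q = x \<bullet> (A *v x)"
    have q: "q > 0" using A False by (simp add: q_def pd_mat_def)
    have "(x /\<^sub>R sqrt q) \<bullet> (E *v (x /\<^sub>R sqrt q)) \<le> l"
      unfolding l_def q_def using norm1[OF that] q by (intro v(2)) (simp add: q_def)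
    then have "inverse (sqrt q) * (inverse (sqrt q) * (x \<bullet> (E *v x))) \<le> l"
      by (simp add: matrix_vector_mult_scaleR)
    moreover have "inverse (sqrt q) * inverse (sqrt q) = inverse q"
      using q by (simp flip: inverse_mult_distrib)
    ultimately have "inverse q * (x \<bullet> (E *v x)) \<le> l"
      by (simp flip: mult.assoc)
    then show ?thesis using q by (simp add: q_def field_simps)
  qed simp
  \<comment> \<open>The bound \<open>ray\<close> is an equality at \<open>v\<close>, so along
    \<open>v + t *\<^sub>R y\<close> only a nonpositive quadratic in \<open>t\<close> without
    constant term remains; its linear coefficient must vanish.\<close>
  have onV: "v \<bullet> (E *v y) = l * (v \<bullet> (A *v y))" if "y \<in> V" for y
  proof -
    have "2 * t * (v \<bullet> (E *v y) - l * (v \<bullet> (A *v y))) + t\<^sup>2 * (y \<bullet> (E *v y) - l * (y \<bullet> (A *v y))) \<le> 0" for t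
    proof -
      have "v + t *\<^sub>R y \<in> V" using that vV by (simp add: V_def inner_add_left)
      from ray[OF this] show ?thesis
        using v1 cA[of y v] cE[of y v]
        by (simp add: matrix_vector_right_distrib matrix_vector_mult_scaleR inner_add_left
            inner_add_right algebra_simps power2_eq_square l_def)
    qed
    from nonpos_quadratic_imp_linear_zero[OF this] show ?thesis by simp
  qed
  have "v \<bullet> (E *v y) = l * (v \<bullet> (A *v y))" for y
  proof -
    \<comment> \<open>The A-orthogonal projection of \<open>y\<close> onto the span of
      \<open>W\<close>. Both forms vanish between \<open>v\<close> and \<open>z\<close>, the one of
      \<open>E\<close> because \<open>W\<close> consists of generalised eigenvectors, so
      \<open>onV\<close> extends from \<open>V\<close> to the whole space.\<close>
    define z where "z = (\<Sum>w\<in>W. (y \<bullet> (A *v w)) *\<^sub>R w)"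
    have "(\<Sum>w\<in>W. (y \<bullet> (A *v w)) * (w \<bullet> (A *v u))) = y \<bullet> (A *v u)" if "u \<in> W" for u
    proof -
      have "(\<Sum>w\<in>W. (y \<bullet> (A *v w)) * (w \<bullet> (A *v u))) = (\<Sum>w\<in>W. if w = u then y \<bullet> (A *v u) else 0)"
        using one orth that by (intro sum.cong) auto
      then show ?thesis using W that by simp
    qed
    then have "y - z \<in> V" by (simp add: V_def z_def inner_diff_left inner_sum_left)
    from onV[OF this] have "v \<bullet> (E *v y) - v \<bullet> (E *v z) = l * (v \<bullet> (A *v y)) - l * (v \<bullet> (A *v z))"
      by (simp add: matrix_vector_mult_diff_distrib inner_diff_right algebra_simps)
    moreover have "v \<bullet> (A *v z) = 0"
      using vV by (simp add: z_def V_def matrix_vector_mult_scaleR inner_sum_right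
          linear_sum[OF matrix_vector_mul_linear])
    moreover have "v \<bullet> (E *v w) = 0" if "w \<in> W" for w
      using eig[OF that] vV that by (auto simp: V_def)
    then have "v \<bullet> (E *v z) = 0"
      by (simp add: z_def matrix_vector_mult_scaleR inner_sum_right
          linear_sum[OF matrix_vector_mul_linear])
    ultimately show ?thesis by simp
  qed
  then have "y \<bullet> (E *v v - l *\<^sub>R (A *v v)) = 0" for y
    using cA[of y v] cE[of y v] by (simp add: inner_diff_right)
  then have "E *v v = l *\<^sub>R (A *v v)"
    using inner_eq_zero_iff by (metis eq_iff_diff_eq_0)
  then show ?thesis using that[of v] v1 vV by (auto simp: V_def)
qed

text \<open>An A-orthonormal set of generalised eigenvectors is grown one vector at a time up to the
  full dimension; \<open>E *v v j = e j *\<^sub>R (A *v v j)\<close> then makes the form of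
  \<open>E\<close> diagonal too.\<close>

lemma simultaneous_diagonalisation:
  fixes A E :: "real^'p^'p"
  assumes A: "pd_mat A" and E: "sym_mat E"
  obtains v :: "'p \<Rightarrow> real^'p" and e :: "'p \<Rightarrow> real"
  where "\<And>i j. v i \<bullet> (A *v v j) = (if i = j then 1 else 0)"
    "\<And>i j. v i \<bullet> (E *v v j) = (if i = j then e i else 0)"
proof -
  let ?P = "\<lambda>W. (\<forall>w\<in>W. w \<bullet> (A *v w) = 1 \<and> (\<exists>e. E *v w = e *\<^sub>R (A *v w))) \<and>
    (\<forall>w\<in>W. \<forall>w'\<in>W. w \<noteq> w' \<longrightarrow> w \<bullet> (A *v w') = 0)"
  have symA: "sym_mat A" using A by (simp add: pd_mat_def)
  have "n \<le> CARD('p) \<Longrightarrow> \<exists>W. finite W \<and> card W = n \<and> ?P W" for n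
  proof (induction n)
    case 0
    show ?case by (intro exI[of _ "{}"]) auto
  next
    case (Suc n)
    then obtain W where W: "finite W" "card W = n" "?P W" by auto
    obtain v where v: "v \<bullet> (A *v v) = 1" "\<And>w. w \<in> W \<Longrightarrow> v \<bullet> (A *v w) = 0"
        "\<exists>e. E *v v = e *\<^sub>R (A *v v)"
      by (rule generalised_eigenvector_exists[OF A E, of W]) (use W Suc.prems in auto)
    have "v \<notin> W" using v by force
    moreover have "w \<bullet> (A *v v) = 0" if "w \<in> W" for w
      using v(2)[OF that] sym_mat_inner[OF symA, of w v] by simp
    then have "?P (insert v W)"
      using W(3) v by auto
    ultimately show ?case using W by (intro exI[of _ "insert v W"]) auto
  qed
  then obtain W where W: "finite W" "card W = CARD('p)" "?P W" by blast
  \<comment> \<open>Indexing the basis by \<open>'p\<close> itself lets it serve as the columns of a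
    square matrix.\<close>
  then obtain v :: "'p \<Rightarrow> real^'p" where v: "bij_betw v UNIV W"
    using finite_same_card_bij[of "UNIV :: 'p set" W] by auto
  have vW: "v i \<in> W" for i using v by (auto simp: bij_betw_def)
  have 1: "v i \<bullet> (A *v v j) = (if i = j then 1 else 0)" for i j
    using W(3) vW v by (auto simp: bij_betw_def inj_eq)
  have "\<forall>i. \<exists>e. E *v v i = e *\<^sub>R (A *v v i)" using W(3) vW by blast
  then obtain e where e: "\<And>i. E *v v i = e i *\<^sub>R (A *v v i)" by metis
  show ?thesis by (rule that[of v e]) (auto simp: 1 e)
qed

section \<open>Determinants under congruence\<close>

definition columns_mat :: "('p \<Rightarrow> real^'p) \<Rightarrow> real^'p^'p" where
  "columns_mat v = (\<chi> i j. v j $ i)"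

text \<open>Identifies \<open>columns_mat v\<close> as the change of basis: congruence by it turns
  \<open>A\<close> into the matrix of its bilinear form on the vectors \<open>v i\<close>.\<close>

lemma columns_mat_congruence:
  "(transpose (columns_mat v) ** (A ** columns_mat v)) $ i $ j = v i \<bullet> (A *v v j)"
  by (simp add: columns_mat_def transpose_def matrix_matrix_mult_def matrix_vector_mult_def inner_vec_def)

lemma det_congruence_diagonal:
  fixes A :: "real^'p^'p"
  assumes "\<And>i j. v i \<bullet> (A *v v j) = (if i = j then d i else 0)"
  shows "(det (columns_mat v))\<^sup>2 * det A = (\<Prod>i\<in>UNIV. d i)"
proof -
  have "det (transpose (columns_mat v) ** (A ** columns_mat v)) = (\<Prod>i\<in>UNIV. d i)"
    by (subst det_diagonal) (auto simp: columns_mat_congruence assms)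
  then show ?thesis by (simp add: det_mul power2_eq_square mult_ac)
qed

text \<open>Diagonalising \<open>A\<close> together with itself makes it congruent to the identity,
  so a square times \<open>det A\<close> equals 1.\<close>

lemma pd_mat_det_pos:
  fixes A :: "real^'p^'p"
  assumes "pd_mat A"
  shows "det A > 0"
proof -
  obtain v :: "'p \<Rightarrow> real^'p" where v: "\<And>i j. v i \<bullet> (A *v v j) = (if i = j then 1 else 0)"
    using simultaneous_diagonalisation[OF assms, of A] assms unfolding pd_mat_def by metis
  have "(det (columns_mat v))\<^sup>2 * det A = 1" using det_congruence_diagonal[OF v] by simp
  then show ?thesis by (metis zero_less_mult_pos zero_less_one zero_le_power2 mult_zero_left less_le)
qed

text \<open>In coordinates diagonalising both matrices, the determinants of \<^term>\<open>A + E\<close> and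
  \<^term>\<open>A - E\<close> are \<^term>\<open>det A\<close> times \<open>\<Prod>(1 + e i)\<close> and \<open>\<Prod>(1 - e i)\<close>, and
  \<open>(1 + e i) (1 - e i) \<le> 1\<close>.\<close>

lemma det_symmetric_perturbation_le:
  fixes A E :: "real^'p^'p"
  assumes A: "pd_mat A" and plus: "pd_mat (A + E)" and minus: "pd_mat (A - E)"
    and eq: "det (A - E) = det (A + E)"
  shows "det (A + E) \<le> det A"
proof -
  have tr: "transpose (X + Y) = transpose X + transpose Y" for X Y :: "real^'p^'p"
    by (simp add: transpose_def vec_eq_iff)
  have "sym_mat E" using plus A tr[of A E] by (auto simp: pd_mat_def sym_mat_def)
  then obtain v :: "'p \<Rightarrow> real^'p" and e
    where v: "\<And>i j. v i \<bullet> (A *v v j) = (if i = j then 1 else 0)"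
      "\<And>i j. v i \<bullet> (E *v v j) = (if i = j then e i else 0)"
    using simultaneous_diagonalisation[OF A] by metis
  define c where "c = (det (columns_mat v))\<^sup>2"
  have cA: "c * det A = 1" using det_congruence_diagonal[OF v(1)] by (simp add: c_def)
  have cp: "c * det (A + E) = (\<Prod>i\<in>UNIV. 1 + e i)"
    unfolding c_def by (rule det_congruence_diagonal)
      (simp add: matrix_vector_mult_add_rdistrib inner_add_right v)
  have cm: "c * det (A - E) = (\<Prod>i\<in>UNIV. 1 - e i)"
    unfolding c_def by (rule det_congruence_diagonal)
      (simp add: matrix_vector_mult_diff_rdistrib inner_diff_right v)
  \<comment> \<open>These are the values of the two perturbed forms at \<open>v i\<close>.\<close>
  have pos: "1 + e i > 0" "1 - e i > 0" for i
  proof -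
    have "v i \<noteq> 0" using v(1)[of i i] by auto
    then have "v i \<bullet> ((A + E) *v v i) > 0" "v i \<bullet> ((A - E) *v v i) > 0"
      using plus minus by (auto simp: pd_mat_def)
    then show "1 + e i > 0" "1 - e i > 0"
      by (auto simp: matrix_vector_mult_add_rdistrib matrix_vector_mult_diff_rdistrib
          inner_add_right inner_diff_right v)
  qed
  \<comment> \<open>As the two perturbed determinants agree, the square of one is their product,
    which pairs the factors for each \<open>i\<close>.\<close>
  have "(c * det (A + E))\<^sup>2 = (\<Prod>i\<in>UNIV. (1 + e i) * (1 - e i))"
    using cp cm eq by (simp add: power2_eq_square prod.distrib)
  also have "\<dots> \<le> 1"
  proof (intro prod_le_1 conjI)
    fix i
    show "0 \<le> (1 + e i) * (1 - e i)" using pos[of i] by simp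
    have "(1 + e i) * (1 - e i) = 1 - (e i)\<^sup>2" by (simp add: algebra_simps power2_eq_square)
    then show "(1 + e i) * (1 - e i) \<le> 1" by simp
  qed
  finally have "c * det (A + E) \<le> 1" by (simp add: power_le_one_iff abs_square_le_1)
  then have "c * det (A + E) \<le> c * det A" using cA by simp
  moreover have "c > 0" using cA by (auto simp: c_def)
  ultimately show ?thesis by simp
qed

subsection \<open>Pinching and Fischer's inequality\<close>

text \<open>The conjugate of \<open>B\<close> by the diagonal matrix \<open>sign_mat U\<close>,
  written entrywise; it negates exactly the entries linking \<open>U\<close> to its
  complement.\<close>

definition flip_mat :: "'p set \<Rightarrow> real^'p^'p \<Rightarrow> real^'p^'p" where
  "flip_mat U B = (\<chi> i j. if i \<in> U \<longleftrightarrow> j \<in> U then B $ i $ j else - B $ i $ j)"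

text \<open>The midpoint of \<open>B\<close> and \<open>flip_mat U B\<close>.\<close>

definition pinch_mat :: "'p set \<Rightarrow> real^'p^'p \<Rightarrow> real^'p^'p" where
  "pinch_mat U B = (\<chi> i j. if i \<in> U \<longleftrightarrow> j \<in> U then B $ i $ j else 0)"

definition sign_mat :: "'p set \<Rightarrow> real^'p^'p" where
  "sign_mat U = (\<chi> i j. if i = j then (if i \<in> U then - 1 else 1) else 0)"

lemma sym_mat_nth: "sym_mat A \<longleftrightarrow> (\<forall>i j. A $ i $ j = A $ j $ i)"
  by (auto simp: sym_mat_def transpose_def vec_eq_iff)

lemma sign_mat_vector: "(sign_mat U *v x) $ i = (if i \<in> U then - x $ i else x $ i)"
  by (simp add: sign_mat_def matrix_vector_mult_def if_distrib[of "\<lambda>c. c * _"] cong: if_cong)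

lemma flip_mat_eq_congruence:
  fixes B :: "real^'a^'a"
  shows "flip_mat U B = sign_mat U ** (B ** sign_mat U)"
proof -
  have "(sign_mat U ** X) $ i $ j = (if i \<in> U then - X $ i $ j else X $ i $ j)" for X :: "real^'a^'a" and i j
    by (simp add: sign_mat_def matrix_matrix_mult_def if_distrib[of "\<lambda>c. c * _"] cong: if_cong)
  moreover have "(X ** sign_mat U) $ i $ j = (if j \<in> U then - X $ i $ j else X $ i $ j)" for X :: "real^'a^'a" and i j
    by (simp add: sign_mat_def matrix_matrix_mult_def if_distrib[of "\<lambda>c. _ * c"] cong: if_cong)
  ultimately show ?thesis by (simp add: flip_mat_def vec_eq_iff)
qed

text \<open>The sign matrix is an involution, so the two factors it contributes multiply to
  1.\<close>

lemma det_flip_mat [simp]: "det (flip_mat U B) = det (B :: real^'p^'p)"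
proof -
  have "sign_mat U ** sign_mat U = (mat 1 :: real^'p^'p)"
    by (simp add: sign_mat_def mat_def matrix_matrix_mult_def vec_eq_iff
        if_distrib[of "\<lambda>c. c * _"] cong: if_cong)
  then have "det (sign_mat U :: real^'p^'p) * det (sign_mat U :: real^'p^'p) = 1"
    by (metis det_I det_mul)
  then show ?thesis by (simp add: flip_mat_eq_congruence det_mul)
qed

lemma sym_mat_flip_mat: "sym_mat B \<Longrightarrow> sym_mat (flip_mat U B)"
  by (auto simp: sym_mat_nth flip_mat_def)

lemma sym_mat_pinch_mat: "sym_mat B \<Longrightarrow> sym_mat (pinch_mat U B)"
  by (auto simp: sym_mat_nth pinch_mat_def)

text \<open>Congruence by the sign matrix only evaluates the form of \<open>B\<close> at a vector
  with some coordinates negated.\<close>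

lemma pd_mat_flip_mat:
  fixes B :: "real^'p^'p"
  assumes "pd_mat B"
  shows "pd_mat (flip_mat U B)"
  unfolding pd_mat_def
proof (intro conjI allI impI)
  show "sym_mat (flip_mat U B)" using assms by (simp add: sym_mat_flip_mat pd_mat_def)
  fix x :: "real^'p" assume "x \<noteq> 0"
  define y where "y = sign_mat U *v x"
  have "y \<noteq> 0" using \<open>x \<noteq> 0\<close> by (auto simp: y_def sign_mat_vector vec_eq_iff split: if_splits)
  have "sym_mat (sign_mat U :: real^'p^'p)" by (auto simp: sym_mat_nth sign_mat_def)
  from sym_mat_inner[OF this, of x "B *v y"]
  have "x \<bullet> (flip_mat U B *v x) = y \<bullet> (B *v y)"
    by (simp add: flip_mat_eq_congruence y_def inner_commute flip: matrix_vector_mul_assoc)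
  also have "\<dots> > 0" using assms \<open>y \<noteq> 0\<close> by (simp add: pd_mat_def)
  finally show "x \<bullet> (flip_mat U B *v x) > 0" .
qed

lemma pd_mat_pinch_mat:
  fixes B :: "real^'p^'p"
  assumes "pd_mat B"
  shows "pd_mat (pinch_mat U B)"
  unfolding pd_mat_def
proof (intro conjI allI impI)
  show "sym_mat (pinch_mat U B)" using assms by (simp add: sym_mat_pinch_mat pd_mat_def)
  fix x :: "real^'p" assume x: "x \<noteq> 0"
  have "B + flip_mat U B = 2 *\<^sub>R pinch_mat U B"
    by (simp add: flip_mat_def pinch_mat_def vec_eq_iff)
  then have "2 * (x \<bullet> (pinch_mat U B *v x)) = x \<bullet> (B *v x) + x \<bullet> (flip_mat U B *v x)"
    by (metis inner_add_right inner_scaleR_right matrix_vector_mult_add_rdistrib scaleR_matrix_vector_assoc)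
  then show "x \<bullet> (pinch_mat U B *v x) > 0"
    using assms pd_mat_flip_mat[OF assms, of U] x unfolding pd_mat_def by fastforce
qed

text \<open>Fischer's inequality: \<open>B\<close> and \<open>flip_mat U B\<close> lie symmetrically
  about the pinching and share their determinant, so the midpoint comparison applies.\<close>

lemma det_le_det_pinch_mat:
  fixes B :: "real^'p^'p"
  assumes "pd_mat B"
  shows "det B \<le> det (pinch_mat U B)"
proof -
  define E where "E = B - pinch_mat U B"
  have plus: "pinch_mat U B + E = B" by (simp add: E_def)
  have minus: "pinch_mat U B - E = flip_mat U B"
    by (simp add: E_def pinch_mat_def flip_mat_def vec_eq_iff)
  show ?thesis
    using det_symmetric_perturbation_le[OF pd_mat_pinch_mat[OF assms, of U], of E]
      assms pd_mat_flip_mat[OF assms] plus minus by simp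
qed

subsection \<open>The fused penalty\<close>

text \<open>The function \<phi> of the overview: besides the two penalties it includes the linear
  trace term of one off-diagonal position, with \<open>s\<close> and \<open>x\<close> its entries
  across the \<open>K\<close> matrices.\<close>

definition fused_penalty :: "nat \<Rightarrow> real \<Rightarrow> real \<Rightarrow> (nat \<Rightarrow> real) \<Rightarrow> (nat \<Rightarrow> real) \<Rightarrow> real" where
  "fused_penalty K \<mu>1 \<mu>2 s x = (\<Sum>k=1..K. s k * x k) + \<mu>1 * (\<Sum>k=1..K. \<bar>x k\<bar>)
     + \<mu>2 * (\<Sum>(k, k') | 1 \<le> k \<and> k < k' \<and> k' \<le> K. \<bar>x k - x k'\<bar>)"

lemma finite_fused_pairs [simp]: "finite {(k, k'). 1 \<le> k \<and> k < k' \<and> k' \<le> (K::nat)}"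
  by (rule finite_subset[of _ "{1..K} \<times> {1..K}"]) auto

text \<open>The square of index pairs splits into two mirror-image triangles and the
  diagonal.\<close>

lemma sum_fused_pairs:
  fixes f :: "nat \<Rightarrow> nat \<Rightarrow> real"
  assumes sym: "\<And>k k'. f k k' = f k' k" and diag: "\<And>k. f k k = 0"
  shows "2 * (\<Sum>(k, k') | 1 \<le> k \<and> k < k' \<and> k' \<le> K. f k k') = (\<Sum>k=1..K. \<Sum>k'=1..K. f k k')"
proof -
  define P where "P = {(k, k'). 1 \<le> k \<and> k < k' \<and> k' \<le> K}"
  define D where "D = (\<lambda>k. (k, k)) ` {1..K}"
  have fin: "finite P" "finite (prod.swap ` P)" "finite D" by (simp_all add: P_def D_def del: One_nat_def)
  have "(\<Sum>k=1..K. \<Sum>k'=1..K. f k k') = (\<Sum>(k, k')\<in>{1..K} \<times> {1..K}. f k k')"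
    by (simp add: sum.cartesian_product)
  also have "{1..K} \<times> {1..K} = (P \<union> prod.swap ` P) \<union> D"
    by (auto simp: P_def D_def image_iff prod.swap_def) 
  also have "(\<Sum>(k, k')\<in>\<dots>. f k k') = (\<Sum>(k, k')\<in>P \<union> prod.swap ` P. f k k') + (\<Sum>(k, k')\<in>D. f k k')"
    using fin by (intro sum.union_disjoint) (auto simp: P_def D_def)
  also have "(\<Sum>(k, k')\<in>D. f k k') = 0" by (intro sum.neutral) (auto simp: D_def diag)
  also have "(\<Sum>(k, k')\<in>P \<union> prod.swap ` P. f k k') = (\<Sum>(k, k')\<in>P. f k k') + (\<Sum>(k, k')\<in>prod.swap ` P. f k k')"
    using fin by (intro sum.union_disjoint) (auto simp: P_def)
  also have "(\<Sum>(k, k')\<in>prod.swap ` P. f k k') = (\<Sum>(k, k')\<in>P. f k k')"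
    by (subst sum.reindex) (auto simp: case_prod_unfold sym intro!: sum.cong)
  finally show ?thesis by (simp add: P_def)
qed

lemma fused_penalty_uminus: "fused_penalty K \<mu>1 \<mu>2 (\<lambda>k. - s k) (\<lambda>k. - x k) = fused_penalty K \<mu>1 \<mu>2 s x"
  by (simp add: fused_penalty_def abs_minus_commute)

text \<open>Positive homogeneity makes the change along a ray from zero exactly linear, although
  absolute values are not differentiable there.\<close>

lemma fused_penalty_scale:
  assumes "c \<ge> 0"
  shows "fused_penalty K \<mu>1 \<mu>2 s (\<lambda>k. c * x k) = c * fused_penalty K \<mu>1 \<mu>2 s x"
proof -
  have "\<bar>c * x k - c * x k'\<bar> = c * \<bar>x k - x k'\<bar>" for k k'
    using assms by (simp add: abs_mult flip: right_diff_distrib)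
  then show ?thesis
    using assms by (simp add: fused_penalty_def abs_mult sum_distrib_left case_prod_unfold
        distrib_left mult.left_commute)
qed

lemma fused_penalty_zero [simp]: "fused_penalty K \<mu>1 \<mu>2 s (\<lambda>k. 0) = 0"
  by (simp add: fused_penalty_def)

lemma fused_penalty_cong:
  "(\<And>k. k \<in> {1..K} \<Longrightarrow> x k = y k) \<Longrightarrow> fused_penalty K \<mu>1 \<mu>2 s x = fused_penalty K \<mu>1 \<mu>2 s y"
  unfolding fused_penalty_def by (intro arg_cong2[where f = "(+)"] arg_cong2[where f = "(*)"] sum.cong) auto

text \<open>The source of the bound in the theorem: the product of \<open>card A\<close> and
  \<open>K - card A\<close> counts the pairs that \<open>A\<close> separates.\<close>

lemma fused_penalty_indicator:
  assumes A: "A \<subseteq> {1..K}"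
  shows "fused_penalty K \<mu>1 \<mu>2 s (\<lambda>k. of_bool (k \<in> A))
    = (\<Sum>k\<in>A. s k) + real (card A) * \<mu>1 + real (card A) * (real K - real (card A)) * \<mu>2"
proof -
  define x where "x = (\<lambda>k. of_bool (k \<in> A) :: real)"
  have x01: "x k = 0 \<or> x k = 1" for k by (simp add: x_def)
  have sumA: "(\<Sum>k=1..K. g k * x k) = (\<Sum>k\<in>A. g k)" for g
  proof -
    have "(\<Sum>k=1..K. g k * x k) = (\<Sum>k\<in>{1..K} \<inter> A. g k)"
      by (simp add: x_def sum.inter_restrict if_distrib[of "\<lambda>c. _ * c"] of_bool_def cong: if_cong)
    then show ?thesis using A by (simp add: Int_absorb1)
  qed
  \<comment> \<open>For values 0 and 1 the absolute difference is a polynomial, so the double sum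
    factors into single sums.\<close>
  have absd: "\<bar>x k - x k'\<bar> = x k + x k' - 2 * (x k * x k')" for k k'
    using x01[of k] x01[of k'] by auto
  have absx: "\<bar>x k\<bar> = x k" for k using x01[of k] by auto
  have cx: "(\<Sum>k=1..K. x k) = real (card A)" using sumA[of "\<lambda>_. 1"] by simp
  have "2 * (\<Sum>(k, k') | 1 \<le> k \<and> k < k' \<and> k' \<le> K. \<bar>x k - x k'\<bar>)
      = (\<Sum>k=1..K. \<Sum>k'=1..K. \<bar>x k - x k'\<bar>)"
    by (rule sum_fused_pairs) auto
  also have "\<dots> = (\<Sum>k=1..K. \<Sum>k'=1..K. x k + x k' - 2 * (x k * x k'))"
    by (simp only: absd)
  also have "\<dots> = (\<Sum>k=1..K. (real K - 2 * real (card A)) * x k + real (card A))"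
  proof (rule sum.cong[OF refl])
    fix k
    have "(\<Sum>k'=1..K. x k + x k' - 2 * (x k * x k'))
        = real K * x k + (\<Sum>k'=1..K. x k') - 2 * x k * (\<Sum>k'=1..K. x k')"
      by (simp add: sum.distrib sum_subtractf sum_distrib_left mult.assoc)
    then show "(\<Sum>k'=1..K. x k + x k' - 2 * (x k * x k')) = (real K - 2 * real (card A)) * x k + real (card A)"
      unfolding cx by (simp add: algebra_simps)
  qed
  also have "\<dots> = (real K - 2 * real (card A)) * (\<Sum>k=1..K. x k) + real K * real (card A)"
    by (simp add: sum.distrib sum_distrib_left)
  also have "\<dots> = 2 * (real (card A) * (real K - real (card A)))"
    unfolding cx by (simp add: algebra_simps)
  finally have pairs: "(\<Sum>(k, k') | 1 \<le> k \<and> k < k' \<and> k' \<le> K. \<bar>x k - x k'\<bar>)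
      = real (card A) * (real K - real (card A))" by simp
  have "fused_penalty K \<mu>1 \<mu>2 s x
    = (\<Sum>k\<in>A. s k) + real (card A) * \<mu>1 + real (card A) * (real K - real (card A)) * \<mu>2"
    unfolding fused_penalty_def pairs sumA absx cx by (simp add: mult_ac)
  then show ?thesis by (simp add: x_def)
qed

text \<open>Layer-cake step: \<^term>\<open>fused_penalty\<close> is additive when the smallest positive value is
  subtracted from all positive entries.\<close>

lemma fused_penalty_peel:
  assumes "\<And>k. k \<in> {1..K} \<Longrightarrow> x k > 0 \<Longrightarrow> m \<le> x k" and "m \<ge> 0"
    and A: "A = {k \<in> {1..K}. x k > 0}"
  shows "fused_penalty K \<mu>1 \<mu>2 s x = m * fused_penalty K \<mu>1 \<mu>2 s (\<lambda>k. of_bool (k \<in> A))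
    + fused_penalty K \<mu>1 \<mu>2 s (\<lambda>k. x k - m * of_bool (k \<in> A))"
proof -
  define a where "a = (\<lambda>k. of_bool (k \<in> A) :: real)"
  define y where "y = (\<lambda>k. x k - m * a k)"
  have "\<bar>x k\<bar> = m * \<bar>a k\<bar> + \<bar>y k\<bar>" if "k \<in> {1..K}" for k
    using assms that by (auto simp: y_def a_def)
  then have 1: "(\<Sum>k=1..K. \<bar>x k\<bar>) = m * (\<Sum>k=1..K. \<bar>a k\<bar>) + (\<Sum>k=1..K. \<bar>y k\<bar>)"
    by (simp add: sum_distrib_left flip: sum.distrib)
  \<comment> \<open>Lowering the positive entries by at most their minimum never reverses the order
    of two entries, so the absolute values add without cancellation.\<close>
  have "\<bar>x k - x k'\<bar> = m * \<bar>a k - a k'\<bar> + \<bar>y k - y k'\<bar>" if "k \<in> {1..K}" "k' \<in> {1..K}" for k k'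
    using assms(1)[OF that(1)] assms(1)[OF that(2)] assms(2) that
    by (cases "x k > 0"; cases "x k' > 0") (auto simp: A a_def y_def)
  then have "(\<Sum>(k, k') | 1 \<le> k \<and> k < k' \<and> k' \<le> K. \<bar>x k - x k'\<bar>)
    = (\<Sum>(k, k') | 1 \<le> k \<and> k < k' \<and> k' \<le> K. m * \<bar>a k - a k'\<bar> + \<bar>y k - y k'\<bar>)"
    by (intro sum.cong) auto
  also have "\<dots> = m * (\<Sum>(k, k') | 1 \<le> k \<and> k < k' \<and> k' \<le> K. \<bar>a k - a k'\<bar>)
    + (\<Sum>(k, k') | 1 \<le> k \<and> k < k' \<and> k' \<le> K. \<bar>y k - y k'\<bar>)"
    by (simp only: case_prod_unfold sum.distrib sum_distrib_left)
  finally have 2: "(\<Sum>(k, k') | 1 \<le> k \<and> k < k' \<and> k' \<le> K. \<bar>x k - x k'\<bar>) = \<dots>" .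
  have 3: "(\<Sum>k=1..K. s k * x k) = m * (\<Sum>k=1..K. s k * a k) + (\<Sum>k=1..K. s k * y k)"
    by (simp add: y_def sum_distrib_left algebra_simps flip: sum.distrib)
  have "fused_penalty K \<mu>1 \<mu>2 s x = m * fused_penalty K \<mu>1 \<mu>2 s a + fused_penalty K \<mu>1 \<mu>2 s y"
    unfolding fused_penalty_def 1 2 3 by (simp add: algebra_simps)
  then show ?thesis by (simp add: y_def a_def)
qed

text \<open>Induction on the number of nonzero entries: each peeled layer is an indicator, where the
  hypothesis applies. Negative entries are reached by reflection, which also negates
  \<open>s\<close>; hence \<open>s\<close> varies in the induction.\<close>

lemma fused_penalty_nonneg:
  assumes "\<And>A. A \<subseteq> {1..K} \<Longrightarrow> A \<noteq> {} \<Longrightarrow>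
    \<bar>\<Sum>k\<in>A. s k\<bar> \<le> real (card A) * \<mu>1 + real (card A) * (real K - real (card A)) * \<mu>2"
  shows "fused_penalty K \<mu>1 \<mu>2 s x \<ge> 0"
  using assms
proof (induction "card {k \<in> {1..K}. x k \<noteq> 0}" arbitrary: s x rule: less_induct)
  case less
  \<comment> \<open>Stated for any vector with at most as many nonzero entries as \<open>x\<close>,
    so that it serves both \<open>x\<close> with \<open>s\<close> and the negated pair.\<close>
  have pos: "fused_penalty K \<mu>1 \<mu>2 s' x' \<ge> 0"
    if ex: "k0 \<in> {1..K}" "x' k0 > 0"
      and card: "card {k \<in> {1..K}. x' k \<noteq> 0} \<le> card {k \<in> {1..K}. x k \<noteq> 0}"
      and cond: "\<And>A. A \<subseteq> {1..K} \<Longrightarrow> A \<noteq> {} \<Longrightarrow>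
        \<bar>\<Sum>k\<in>A. s' k\<bar> \<le> real (card A) * \<mu>1 + real (card A) * (real K - real (card A)) * \<mu>2"
    for s' x' k0
  proof -
    define A where "A = {k \<in> {1..K}. x' k > 0}"
    have A: "finite A" "A \<noteq> {}" "A \<subseteq> {1..K}" using ex by (auto simp: A_def)
    define m where "m = Min (x' ` A)"
    have m_le: "m \<le> x' k" if "k \<in> {1..K}" "x' k > 0" for k
      unfolding m_def using A that by (intro Min_le) (auto simp: A_def)
    have "m \<in> x' ` A" unfolding m_def using A by (intro Min_in) auto
    then obtain k1 where k1: "k1 \<in> A" "x' k1 = m" by auto
    then have m: "m > 0" by (auto simp: A_def)
    define y where "y = (\<lambda>k. x' k - m * of_bool (k \<in> A))"
    have "{k \<in> {1..K}. y k \<noteq> 0} \<subseteq> {k \<in> {1..K}. x' k \<noteq> 0}"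
      by (auto simp: y_def A_def)
    \<comment> \<open>The entry attaining the minimum drops to zero, which makes the support
      strictly smaller.\<close>
    moreover have "k1 \<in> {k \<in> {1..K}. x' k \<noteq> 0} - {k \<in> {1..K}. y k \<noteq> 0}"
      using k1 m by (auto simp: y_def A_def)
    ultimately have "card {k \<in> {1..K}. y k \<noteq> 0} < card {k \<in> {1..K}. x' k \<noteq> 0}"
      by (intro psubset_card_mono) auto
    then have "card {k \<in> {1..K}. y k \<noteq> 0} < card {k \<in> {1..K}. x k \<noteq> 0}"
      using card by linarith
    then have "fused_penalty K \<mu>1 \<mu>2 s' y \<ge> 0" by (rule less.hyps) (rule cond)
    moreover have "fused_penalty K \<mu>1 \<mu>2 s' (\<lambda>k. of_bool (k \<in> A)) \<ge> 0"
      unfolding fused_penalty_indicator[OF A(3)] using cond[OF A(3,2)] by linarith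
    ultimately show ?thesis
      using fused_penalty_peel[where x = x' and m = m and s = s', OF m_le _ A_def] m
      by (simp add: y_def)
  qed
  consider "\<exists>k\<in>{1..K}. x k > 0" | "\<exists>k\<in>{1..K}. x k < 0" | "\<forall>k\<in>{1..K}. \<not> x k > 0 \<and> \<not> x k < 0"
    by blast
  then show ?case
  proof cases
    case 1
    then obtain k where "k \<in> {1..K}" "x k > 0" by blast
    from pos[OF this order_refl less.prems] show ?thesis .
  next
    case 2
    then obtain k where k: "k \<in> {1..K}" "- x k > 0" by auto
    have "card {k \<in> {1..K}. - x k \<noteq> 0} \<le> card {k \<in> {1..K}. x k \<noteq> 0}" by simp
    moreover have "\<bar>\<Sum>k\<in>A. - s k\<bar> \<le> real (card A) * \<mu>1 + real (card A) * (real K - real (card A)) * \<mu>2"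
      if "A \<subseteq> {1..K}" "A \<noteq> {}" for A
      using less.prems[OF that] by (simp add: sum_negf)
    ultimately have "fused_penalty K \<mu>1 \<mu>2 (\<lambda>k. - s k) (\<lambda>k. - x k) \<ge> 0"
      by (rule pos[of k "\<lambda>k. - x k" "\<lambda>k. - s k", OF k])
    then show ?thesis by (simp only: fused_penalty_uminus)
  next
    case 3
    then have "fused_penalty K \<mu>1 \<mu>2 s x = fused_penalty K \<mu>1 \<mu>2 s (\<lambda>k. 0)"
      by (intro fused_penalty_cong) force
    then show ?thesis by simp
  qed
qed

subsection \<open>Optimal solutions\<close>

text \<open>Everything in the objective outside the off-diagonal positions. Moving off-diagonal
  entries affects it through the determinants alone.\<close>

definition logdet_diag_part :: "nat \<Rightarrow> (nat \<Rightarrow> real^'p^'p) \<Rightarrow> (nat \<Rightarrow> real^'p^'p) \<Rightarrow> real" where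
  "logdet_diag_part K S \<Theta> =
     (\<Sum>k=1..K. - ln (det (\<Theta> k))) + (\<Sum>k=1..K. \<Sum>i\<in>UNIV. S k $ i $ i * \<Theta> k $ i $ i)"

lemma objective_eq_infinity:
  assumes "k \<in> {1..K}" "\<not> pd_mat (\<Theta> k)"
  shows "objective K S \<mu>1 \<mu>2 \<Theta> = \<infinity>"
proof -
  have "(\<Sum>k=1..K. neg_logdet (\<Theta> k) + ereal (trace_inner (S k) (\<Theta> k))) = \<infinity>"
    unfolding sum_Pinfty using assms by (intro conjI bexI[of _ k]) (auto simp: neg_logdet_def)
  then show ?thesis by (simp add: objective_def)
qed

lemma trace_inner_eq_sum:
  fixes A B :: "real^'p^'p"
  shows "trace_inner A B = (\<Sum>i\<in>UNIV. \<Sum>j\<in>UNIV. A $ i $ j * B $ i $ j)"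
  unfolding trace_inner_def trace_def matrix_matrix_mult_def transpose_def
  by (simp, rule sum.swap)

lemma sum_diagonal_offdiagonal:
  fixes f :: "'p::finite \<Rightarrow> 'p \<Rightarrow> real"
  shows "(\<Sum>i\<in>UNIV. \<Sum>j\<in>UNIV. f i j) = (\<Sum>i\<in>UNIV. f i i) + (\<Sum>(i, j) | i \<noteq> j. f i j)"
proof -
  have "(\<Sum>i\<in>UNIV. \<Sum>j\<in>UNIV. f i j) = (\<Sum>(i, j)\<in>UNIV. f i j)"
    by (simp add: sum.cartesian_product)
  also have "UNIV = (\<lambda>i. (i, i)) ` (UNIV :: 'p set) \<union> {(i, j). i \<noteq> j}" by auto
  also have "(\<Sum>(i, j)\<in>\<dots>. f i j) = (\<Sum>(i, j)\<in>(\<lambda>i. (i, i)) ` UNIV. f i j) + (\<Sum>(i, j) | i \<noteq> j. f i j)"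
    by (rule sum.union_disjoint) auto
  also have "(\<Sum>(i, j)\<in>(\<lambda>i. (i, i)) ` UNIV. f i j) = (\<Sum>i\<in>UNIV. f i i)"
    by (subst sum.reindex) (auto simp: inj_on_def)
  finally show ?thesis .
qed

text \<open>All terms are finite here, and the off-diagonal part of each trace inner product joins
  the penalties of the same ordered pair.\<close>

lemma objective_pd_mat:
  fixes S \<Theta> :: "nat \<Rightarrow> real^'p^'p"
  assumes "\<forall>k\<in>{1..K}. pd_mat (\<Theta> k)"
  shows "objective K S \<mu>1 \<mu>2 \<Theta> = ereal (logdet_diag_part K S \<Theta>
    + (\<Sum>(i, j) | i \<noteq> j. fused_penalty K \<mu>1 \<mu>2 (\<lambda>k. S k $ i $ j) (\<lambda>k. \<Theta> k $ i $ j)))"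
proof -
  have "(\<Sum>k=1..K. neg_logdet (\<Theta> k) + ereal (trace_inner (S k) (\<Theta> k)))
      = (\<Sum>k=1..K. ereal (- ln (det (\<Theta> k)) + trace_inner (S k) (\<Theta> k)))"
    using assms by (intro sum.cong) (auto simp: neg_logdet_def)
  also have "\<dots> = ereal (\<Sum>k=1..K. - ln (det (\<Theta> k)) + trace_inner (S k) (\<Theta> k))"
    by (rule sum_ereal)
  also have "(\<Sum>k=1..K. - ln (det (\<Theta> k)) + trace_inner (S k) (\<Theta> k))
     = logdet_diag_part K S \<Theta> + (\<Sum>(i, j) | i \<noteq> j. \<Sum>k=1..K. S k $ i $ j * \<Theta> k $ i $ j)"
    unfolding logdet_diag_part_def trace_inner_eq_sum sum_diagonal_offdiagonal sum.distrib
    by (simp add: case_prod_unfold) (rule sum.swap)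
  finally show ?thesis
    unfolding objective_def fused_penalty_def case_prod_unfold
    by (simp add: sum.distrib sum_distrib_left)
qed

section \<open>Minimisers and their pinchings\<close>

lemma optimal_solution_iff_le:
  "optimal_solution K S \<mu>1 \<mu>2 \<Theta> \<longleftrightarrow> (\<forall>k\<in>{1..K}. sym_mat (\<Theta> k)) \<and>
    (\<forall>\<Psi>. (\<forall>k\<in>{1..K}. sym_mat (\<Psi> k)) \<longrightarrow> objective K S \<mu>1 \<mu>2 \<Theta> \<le> objective K S \<mu>1 \<mu>2 \<Psi>)"
  by (simp add: optimal_solution_def is_arg_min_linorder)

lemma optimal_solution_pd_mat:
  fixes S \<Theta> :: "nat \<Rightarrow> real^'p^'p"
  assumes "optimal_solution K S \<mu>1 \<mu>2 \<Theta>" "k \<in> {1..K}"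
  shows "pd_mat (\<Theta> k)"
proof (rule ccontr)
  assume "\<not> pd_mat (\<Theta> k)"
  then have inf: "objective K S \<mu>1 \<mu>2 \<Theta> = \<infinity>" using assms objective_eq_infinity by blast
  \<comment> \<open>The identity tuple has a finite objective, so an infinite value cannot be
    minimal.\<close>
  define I where "I = (\<lambda>k::nat. mat 1 :: real^'p^'p)"
  have pd: "pd_mat (I k)" for k by (simp add: I_def pd_mat_def sym_mat_def)
  then have "sym_mat (I k)" for k by (simp add: pd_mat_def)
  then have "objective K S \<mu>1 \<mu>2 \<Theta> \<le> objective K S \<mu>1 \<mu>2 I"
    using assms(1) by (simp add: optimal_solution_iff_le)
  then show False using inf objective_pd_mat[of K I S] pd by simp
qed

text \<open>Pinching keeps the diagonal, does not decrease the determinants, and replaces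
  nonnegative values of \<open>fused_penalty\<close> across the cut by zero, so the objective does
  not grow.\<close>

lemma optimal_solution_pinch_mat:
  fixes S \<Theta> :: "nat \<Rightarrow> real^'p^'p"
  assumes opt: "optimal_solution K S \<mu>1 \<mu>2 \<Theta>"
    and S: "\<And>k. k \<in> {1..K} \<Longrightarrow> sym_mat (S k)"
    and cond: "\<And>A i j. A \<subseteq> {1..K} \<Longrightarrow> A \<noteq> {} \<Longrightarrow> i \<in> U \<Longrightarrow> j \<notin> U \<Longrightarrow>
      \<bar>\<Sum>k\<in>A. S k $ i $ j\<bar> \<le> real (card A) * \<mu>1 + real (card A) * (real K - real (card A)) * \<mu>2"
  shows "optimal_solution K S \<mu>1 \<mu>2 (\<lambda>k. pinch_mat U (\<Theta> k))"
proof -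
  let ?\<Psi> = "\<lambda>k. pinch_mat U (\<Theta> k)"
  let ?f = "\<lambda>\<Theta> i j. fused_penalty K \<mu>1 \<mu>2 (\<lambda>k. S k $ i $ j) (\<lambda>k. \<Theta> k $ i $ j)"
  have pd: "pd_mat (\<Theta> k)" if "k \<in> {1..K}" for k using optimal_solution_pd_mat[OF opt that] .
  then have pd': "pd_mat (?\<Psi> k)" if "k \<in> {1..K}" for k using pd_mat_pinch_mat that by blast
  have "- ln (det (?\<Psi> k)) \<le> - ln (det (\<Theta> k))" if "k \<in> {1..K}" for k
    using det_le_det_pinch_mat[OF pd[OF that], of U] pd_mat_det_pos[OF pd[OF that]]
      pd_mat_det_pos[OF pd'[OF that]] by simp
  then have "logdet_diag_part K S ?\<Psi> \<le> logdet_diag_part K S \<Theta>"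
    unfolding logdet_diag_part_def by (intro add_mono sum_mono) (auto simp: pinch_mat_def)
  moreover have "?f ?\<Psi> i j \<le> ?f \<Theta> i j" for i j
  proof (cases "i \<in> U \<longleftrightarrow> j \<in> U")
    case False
    have "\<bar>\<Sum>k\<in>A. S k $ i $ j\<bar> \<le> real (card A) * \<mu>1 + real (card A) * (real K - real (card A)) * \<mu>2"
      if A: "A \<subseteq> {1..K}" "A \<noteq> {}" for A
    proof (cases "i \<in> U")
      case True
      then show ?thesis using cond[OF A] False by blast
    next
      \<comment> \<open>The hypothesis covers only rows in \<open>U\<close>; symmetry of
        \<open>S\<close> transfers it to the transposed position.\<close>
      case i: False
      have "(\<Sum>k\<in>A. S k $ i $ j) = (\<Sum>k\<in>A. S k $ j $ i)"
        using S A by (intro sum.cong) (auto simp: sym_mat_nth)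
      then show ?thesis using cond[OF A, of j i] i False by simp
    qed
    from fused_penalty_nonneg[OF this] False show ?thesis by (simp add: pinch_mat_def)
  qed (simp add: pinch_mat_def)
  then have "(\<Sum>(i, j) | i \<noteq> j. ?f ?\<Psi> i j) \<le> (\<Sum>(i, j) | i \<noteq> j. ?f \<Theta> i j)"
    by (intro sum_mono) auto
  ultimately have "objective K S \<mu>1 \<mu>2 ?\<Psi> \<le> objective K S \<mu>1 \<mu>2 \<Theta>"
    using pd pd' objective_pd_mat[of K \<Theta> S \<mu>1 \<mu>2] objective_pd_mat[of K ?\<Psi> S \<mu>1 \<mu>2] by simp
  moreover have "sym_mat (?\<Psi> k)" if "k \<in> {1..K}" for k using pd'[OF that] by (simp add: pd_mat_def)
  ultimately show ?thesis
    using opt unfolding optimal_solution_iff_le by (auto intro: order_trans)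
qed

section \<open>First-order behaviour at a block diagonal optimum\<close>

lemma det_line_differentiable:
  fixes M X :: "real^'p^'p"
  obtains d where "((\<lambda>t. det (M + t *\<^sub>R X)) has_real_derivative d) (at 0)"
proof -
  \<comment> \<open>The Leibniz expansion with linear polynomials as entries shows that the
    determinant is a polynomial in \<open>t\<close>.\<close>
  define q where "q = (\<Sum>\<pi> | \<pi> permutes (UNIV :: 'p set).
    [:of_int (sign \<pi>):] * (\<Prod>i\<in>UNIV. [:M $ i $ \<pi> i, X $ i $ \<pi> i:]))"
  have "det (M + t *\<^sub>R X) = poly q t" for t
    by (simp add: det_def q_def poly_sum poly_prod)
  then have "((\<lambda>t. det (M + t *\<^sub>R X)) has_real_derivative poly (pderiv q) 0) (at 0)"
    using poly_DERIV[of q 0] by simp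
  then show ?thesis by (rule that)
qed

lemma even_derivative_zero:
  assumes d: "(g has_real_derivative d) (at 0)" and even: "\<And>t. g (- t) = g t"
  shows "d = 0"
proof -
  have "((\<lambda>t. - t) has_real_derivative - 1) (at (0::real))"
    by (auto intro!: derivative_eq_intros)
  moreover have "(g has_real_derivative d) (at (- 0))" using d by simp
  ultimately have "((\<lambda>t. g (- t)) has_real_derivative d * - 1) (at 0)"
    by (rule DERIV_chain2[rotated])
  then have "(g has_real_derivative d * - 1) (at 0)" by (simp only: even)
  from DERIV_unique[OF this d] have "d * - 1 = d" .
  then show ?thesis by simp
qed

text \<open>Positive definiteness is an open condition: the lower bound \<open>c\<close> for
  \<open>M\<close> beats the operator bound \<open>b\<close> for \<open>X\<close> as long as
  \<open>\<bar>t\<bar> < c / b\<close>.\<close>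

lemma pd_mat_perturbation:
  fixes M X :: "real^'p^'p"
  assumes "pd_mat M" "sym_mat X"
  obtains \<delta> where "\<delta> > 0" "\<And>t. \<bar>t\<bar> < \<delta> \<Longrightarrow> pd_mat (M + t *\<^sub>R X)"
proof -
  obtain c where c: "c > 0" "\<And>x. c * (norm x)\<^sup>2 \<le> x \<bullet> (M *v x)"
    using pd_mat_quadratic_lower_bound[OF assms(1)] by blast
  obtain b where b: "b > 0" "\<And>x. norm (X *v x) \<le> norm x * b"
    using bounded_linear.pos_bounded[OF matrix_vector_mul_bounded_linear[of X]] by blast
  have "pd_mat (M + t *\<^sub>R X)" if t: "\<bar>t\<bar> < c / b" for t
    unfolding pd_mat_def
  proof (intro conjI allI impI)
    show "sym_mat (M + t *\<^sub>R X)" using assms by (simp add: pd_mat_def sym_mat_nth)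
    fix x :: "real^'p" assume x: "x \<noteq> 0"
    have "\<bar>x \<bullet> (X *v x)\<bar> \<le> norm x * norm (X *v x)" by (rule Cauchy_Schwarz_ineq2)
    also have "\<dots> \<le> b * (norm x)\<^sup>2"
      using mult_left_mono[OF b(2)[of x], of "norm x"] by (simp add: power2_eq_square mult_ac)
    finally have "\<bar>t * (x \<bullet> (X *v x))\<bar> \<le> \<bar>t\<bar> * (b * (norm x)\<^sup>2)"
      by (simp add: abs_mult mult_left_mono)
    also have "\<dots> = (\<bar>t\<bar> * b) * (norm x)\<^sup>2" by simp
    also have "\<dots> < c * (norm x)\<^sup>2"
      using t b x by (intro mult_strict_right_mono) (auto simp: field_simps)
    also have "\<dots> \<le> x \<bullet> (M *v x)" by (rule c)
    finally show "x \<bullet> ((M + t *\<^sub>R X) *v x) > 0"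
      by (simp add: matrix_vector_mult_add_rdistrib inner_add_right flip: scaleR_matrix_vector_assoc)
  qed
  then show ?thesis using that[of "c / b"] b c by simp
qed

text \<open>Moving both mirrored entries keeps the perturbed tuple symmetric, hence
  feasible.\<close>

definition sym_unit_mat :: "'p \<Rightarrow> 'p \<Rightarrow> real^'p^'p" where
  "sym_unit_mat i j = (\<chi> a b. of_bool ((a = i \<and> b = j) \<or> (a = j \<and> b = i)))"

lemma sym_mat_sym_unit_mat: "sym_mat (sym_unit_mat i j)"
  by (auto simp: sym_mat_nth sym_unit_mat_def)

text \<open>Conjugation by the sign matrix of \<open>U\<close> shows that the determinant is even along the
  perturbation, so the log-determinants contribute no first-order term.\<close>

lemma optimal_solution_offblock:
  fixes S \<Theta> :: "nat \<Rightarrow> real^'p^'p"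
  assumes opt: "optimal_solution K S \<mu>1 \<mu>2 \<Theta>"
    and S: "\<And>k. k \<in> {1..K} \<Longrightarrow> sym_mat (S k)"
    and U: "\<And>k a b. k \<in> {1..K} \<Longrightarrow> (a \<in> U) \<noteq> (b \<in> U) \<Longrightarrow> \<Theta> k $ a $ b = 0"
    and ij: "i \<in> U" "j \<notin> U"
  shows "fused_penalty K \<mu>1 \<mu>2 (\<lambda>k. S k $ i $ j) x \<ge> 0"
proof (rule ccontr)
  assume neg: "\<not> ?thesis"
  define X where "X = (\<lambda>k. x k *\<^sub>R sym_unit_mat i j)"
  define \<Theta>' where "\<Theta>' = (\<lambda>t k. \<Theta> k + t *\<^sub>R X k)"
  define \<phi> where "\<phi> = fused_penalty K \<mu>1 \<mu>2 (\<lambda>k. S k $ i $ j) x"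
  let ?f = "\<lambda>\<Theta> a b. fused_penalty K \<mu>1 \<mu>2 (\<lambda>k. S k $ a $ b) (\<lambda>k. \<Theta> k $ a $ b)"
  have pd: "pd_mat (\<Theta> k)" if "k \<in> {1..K}" for k using optimal_solution_pd_mat[OF opt that] .
  have symX: "sym_mat (X k)" for k
    using sym_mat_sym_unit_mat[of i j] by (simp add: X_def sym_mat_nth)
  have X_entry: "X k $ a $ b = (if (a, b) \<in> {(i, j), (j, i)} then x k else 0)" for k a b
    by (auto simp: X_def sym_unit_mat_def)
  have "i \<noteq> j" using ij by auto

  have deriv: "((\<lambda>t. - ln (det (\<Theta>' t k))) has_real_derivative 0) (at 0)" if k: "k \<in> {1..K}" for k
  proof -
    obtain d where d: "((\<lambda>t. det (\<Theta>' t k)) has_real_derivative d) (at 0)"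
      unfolding \<Theta>'_def by (rule det_line_differentiable)
    \<comment> \<open>\<open>\<Theta> k\<close> vanishes across the cut and \<open>X k\<close> lives
      only there, so flipping signs amounts to reversing \<open>t\<close>.\<close>
    have "flip_mat U (\<Theta>' t k) = \<Theta>' (- t) k" for t
      using U[OF k] ij by (auto simp: flip_mat_def vec_eq_iff \<Theta>'_def X_entry)
    then have "det (\<Theta>' (- t) k) = det (\<Theta>' t k)" for t by (metis det_flip_mat)
    from even_derivative_zero[OF d this] have "d = 0" .
    then show ?thesis
      using d pd_mat_det_pos[OF pd[OF k]]
      by (auto intro!: derivative_eq_intros simp: \<Theta>'_def)
  qed

  \<comment> \<open>For small \<open>t \<ge> 0\<close> this is the objective along the line up to a
    constant; the factor 2 counts the positions \<open>(i, j)\<close> and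
    \<open>(j, i)\<close>.\<close>
  define F where "F = (\<lambda>t. (\<Sum>k=1..K. - ln (det (\<Theta>' t k))) + 2 * t * \<phi>)"
  have "((\<lambda>t. \<Sum>k=1..K. - ln (det (\<Theta>' t k))) has_real_derivative (\<Sum>k=1..K. 0)) (at 0)"
    by (intro DERIV_sum deriv)
  moreover have "((\<lambda>t. 2 * t * \<phi>) has_real_derivative 2 * \<phi>) (at 0)"
    by (auto intro!: derivative_eq_intros)
  ultimately have "(F has_real_derivative 2 * \<phi>) (at 0)"
    unfolding F_def using DERIV_add by fastforce
  moreover have "2 * \<phi> < 0" using neg by (simp add: \<phi>_def)
  ultimately obtain \<delta> where \<delta>: "\<delta> > 0" "\<And>h. h > 0 \<Longrightarrow> h < \<delta> \<Longrightarrow> F h < F 0"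
    using DERIV_neg_dec_right[of F "2 * \<phi>" 0] by auto

  have "\<forall>k\<in>{1..K}. \<exists>\<delta>>0. \<forall>t. \<bar>t\<bar> < \<delta> \<longrightarrow> pd_mat (\<Theta>' t k)"
    unfolding \<Theta>'_def using pd_mat_perturbation[OF pd symX] by blast
  then obtain r where r: "\<And>k. k \<in> {1..K} \<Longrightarrow> r k > 0"
    "\<And>k t. k \<in> {1..K} \<Longrightarrow> \<bar>t\<bar> < r k \<Longrightarrow> pd_mat (\<Theta>' t k)"
    by metis
  \<comment> \<open>One step size must serve all \<open>K\<close> matrices and the decrease of
    \<open>F\<close>; halving it makes every bound strict.\<close>
  define m where "m = Min (insert \<delta> (r ` {1..K}))"
  define h where "h = m / 2"
  have m: "m > 0" "m \<le> \<delta>" unfolding m_def using \<delta> r by auto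
  then have h: "h > 0" "h < \<delta>" by (auto simp: h_def)
  have hr: "h < r k" if "k \<in> {1..K}" for k
  proof -
    have "m \<le> r k" unfolding m_def using that by (intro Min_le) auto
    then show ?thesis using m by (simp add: h_def)
  qed
  have pd': "pd_mat (\<Theta>' h k)" if "k \<in> {1..K}" for k using r(2)[OF that, of h] h hr[OF that] by simp

  \<comment> \<open>Both moved entries start from zero, so homogeneity gives the exact increment;
    symmetry of \<open>S\<close> makes it the same at \<open>(j, i)\<close>.\<close>
  have f: "?f (\<Theta>' h) a b = ?f \<Theta> a b + (if (a, b) \<in> {(i, j), (j, i)} then h * \<phi> else 0)" for a b
  proof (cases "(a, b) \<in> {(i, j), (j, i)}")
    case True
    then have "(a \<in> U) \<noteq> (b \<in> U)" using ij by auto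
    then have "?f \<Theta> a b = fused_penalty K \<mu>1 \<mu>2 (\<lambda>k. S k $ a $ b) (\<lambda>k. 0)"
      by (intro fused_penalty_cong U)
    moreover have "?f (\<Theta>' h) a b = fused_penalty K \<mu>1 \<mu>2 (\<lambda>k. S k $ a $ b) (\<lambda>k. h * x k)"
      using True U \<open>(a \<in> U) \<noteq> (b \<in> U)\<close> by (intro fused_penalty_cong) (auto simp: \<Theta>'_def X_entry)
    moreover have "fused_penalty K \<mu>1 \<mu>2 (\<lambda>k. S k $ a $ b) x = \<phi>"
      using True S unfolding \<phi>_def fused_penalty_def
      by (intro arg_cong2[where f = "(+)"] refl sum.cong) (auto simp: sym_mat_nth)
    ultimately show ?thesis using True h by (simp add: fused_penalty_scale)
  next
    case False
    then have "X k $ a $ b = 0" for k by (simp only: X_entry if_False)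
    then show ?thesis using False by (auto simp: \<Theta>'_def)
  qed
  have "(\<Sum>(a, b) | a \<noteq> b. if (a, b) \<in> {(i, j), (j, i)} then h * \<phi> else 0)
      = (\<Sum>p\<in>{(i, j), (j, i)}. h * \<phi>)"
    using \<open>i \<noteq> j\<close> by (intro sum.mono_neutral_cong_right) (auto split: if_splits)
  also have "\<dots> = 2 * h * \<phi>" using \<open>i \<noteq> j\<close> by simp
  finally have "(\<Sum>(a, b) | a \<noteq> b. ?f (\<Theta>' h) a b) = (\<Sum>(a, b) | a \<noteq> b. ?f \<Theta> a b) + 2 * h * \<phi>"
    unfolding f by (simp add: case_prod_unfold sum.distrib)
  moreover have "logdet_diag_part K S (\<Theta>' h) + 2 * h * \<phi> < logdet_diag_part K S \<Theta>"
  proof -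
    have "\<Theta>' h k $ a $ a = \<Theta> k $ a $ a" for k a using \<open>i \<noteq> j\<close> by (auto simp: \<Theta>'_def X_entry)
    moreover have "\<Theta>' 0 = \<Theta>" by (simp add: \<Theta>'_def)
    ultimately show ?thesis
      using \<delta>(2)[OF h(1,2)] by (simp add: logdet_diag_part_def F_def)
  qed
  ultimately have "objective K S \<mu>1 \<mu>2 (\<Theta>' h) < objective K S \<mu>1 \<mu>2 \<Theta>"
    using pd pd' objective_pd_mat[of K \<Theta> S \<mu>1 \<mu>2] objective_pd_mat[of K "\<Theta>' h" S \<mu>1 \<mu>2] by simp
  moreover have "\<forall>k\<in>{1..K}. sym_mat (\<Theta>' h k)" using pd' by (simp add: pd_mat_def)
  then have "objective K S \<mu>1 \<mu>2 \<Theta> \<le> objective K S \<mu>1 \<mu>2 (\<Theta>' h)"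
    using opt by (simp add: optimal_solution_iff_le)
  ultimately show False by simp
qed

section \<open>From one cut \<open>U\<close> to the whole family of blocks\<close>

theorem theorem6:
  fixes S :: "nat \<Rightarrow> real^'p^'p"
    and K T :: nat
    and \<mu>1 \<mu>2 :: real
    and C :: "nat \<Rightarrow> 'p set"
  assumes "K \<ge> 1"
    and "\<And>k. k \<in> {1..K} \<Longrightarrow> psd_mat (S k)"
    and "\<mu>1 > 0" and "\<mu>2 > 0"
    and "\<exists>\<Theta>. optimal_solution K S \<mu>1 \<mu>2 \<Theta>"
    and "disjoint_family_on C {1..T}"
    and "(\<Union>t\<in>{1..T}. C t) = UNIV"
  shows "(\<exists>\<Theta>. optimal_solution K S \<mu>1 \<mu>2 \<Theta> \<and> block_diagonal K T C \<Theta>) \<longleftrightarrow>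
    (\<forall>A. A \<subseteq> {1..K} \<and> A \<noteq> {} \<longrightarrow>
      (\<forall>t\<in>{1..T}. \<forall>t'\<in>{1..T}. t \<noteq> t' \<longrightarrow>
        (\<forall>i\<in>C t. \<forall>j\<in>C t'.
          \<bar>\<Sum>k\<in>A. S k $ i $ j\<bar>
            \<le> real (card A) * \<mu>1 + real (card A) * (real K - real (card A)) * \<mu>2)))"
proof -
  have S: "sym_mat (S k)" if "k \<in> {1..K}" for k using assms(2)[OF that] by (simp add: psd_mat_def)
  have disj: "j \<notin> C t" if "t \<in> {1..T}" "t' \<in> {1..T}" "t \<noteq> t'" "j \<in> C t'" for t t' j
    using assms(6) that unfolding disjoint_family_on_def by blast
  have cover: "\<exists>t'\<in>{1..T}. t \<noteq> t' \<and> j \<in> C t'" if "j \<notin> C t" for t j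
  proof -
    have "j \<in> (\<Union>t\<in>{1..T}. C t)" using assms(7) by simp
    then obtain t' where t': "t' \<in> {1..T}" "j \<in> C t'" by (rule UN_E)
    then have "t \<noteq> t'" using that by auto
    with t' show ?thesis by auto
  qed
  show ?thesis
  proof (intro iffI allI impI ballI)
    fix A t t' i j
    assume ex: "\<exists>\<Theta>. optimal_solution K S \<mu>1 \<mu>2 \<Theta> \<and> block_diagonal K T C \<Theta>"
      and A: "A \<subseteq> {1..K} \<and> A \<noteq> {}"
      and t: "t \<in> {1..T}" "t' \<in> {1..T}" "t \<noteq> t'" and ij: "i \<in> C t" "j \<in> C t'"
    obtain \<Theta> where opt: "optimal_solution K S \<mu>1 \<mu>2 \<Theta>" and bd: "block_diagonal K T C \<Theta>"
      using ex by blast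
    have zero: "\<Theta> k $ a $ b = 0"
      if "u \<in> {1..T}" "u' \<in> {1..T}" "u \<noteq> u'" "a \<in> C u" "b \<in> C u'" "k \<in> {1..K}" for k a b u u'
      using bd that unfolding block_diagonal_def by simp
    \<comment> \<open>Since the blocks cover all indices, whatever lies outside \<open>C t\<close>
      lies in another block; block diagonality thus yields the single cut
      \<open>U = C t\<close>.\<close>
    have U: "\<Theta> k $ a $ b = 0" if k: "k \<in> {1..K}" and ab: "(a \<in> C t) \<noteq> (b \<in> C t)" for k a b
    proof (cases "a \<in> C t")
      case True
      then have "b \<notin> C t" using ab by simp
      then obtain u where "u \<in> {1..T}" "t \<noteq> u" "b \<in> C u" using cover by blast
      then show ?thesis using zero[OF t(1) _ _ True _ k] by blast
    next
      case False
      then have b: "b \<in> C t" using ab by simp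
      obtain u where u: "u \<in> {1..T}" "t \<noteq> u" "a \<in> C u" using cover[OF False] by blast
      show ?thesis by (rule zero[OF u(1) t(1) u(2)[symmetric] u(3) b k])
    qed
    \<comment> \<open>Testing nonnegativity at this indicator and at its negative gives the two
      sides of the absolute value bound.\<close>
    define x where "x = (\<lambda>k. of_bool (k \<in> A) :: real)"
    have nonneg: "fused_penalty K \<mu>1 \<mu>2 (\<lambda>k. S k $ i $ j) y \<ge> 0" for y
      using optimal_solution_offblock[OF opt S U ij(1) disj[OF t ij(2)]] .
    have "fused_penalty K \<mu>1 \<mu>2 (\<lambda>k. - S k $ i $ j) x \<ge> 0"
      using nonneg[of "\<lambda>k. - x k"]
        fused_penalty_uminus[of K \<mu>1 \<mu>2 "\<lambda>k. S k $ i $ j" "\<lambda>k. - x k"] by simp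
    moreover have "fused_penalty K \<mu>1 \<mu>2 (\<lambda>k. S k $ i $ j) x \<ge> 0" by (rule nonneg)
    moreover note fused_penalty_indicator[OF conjunct1[OF A], of \<mu>1 \<mu>2, folded x_def]
    ultimately show "\<bar>\<Sum>k\<in>A. S k $ i $ j\<bar>
        \<le> real (card A) * \<mu>1 + real (card A) * (real K - real (card A)) * \<mu>2"
      by (simp add: sum_negf abs_le_iff)
  next
    assume cond: "\<forall>A. A \<subseteq> {1..K} \<and> A \<noteq> {} \<longrightarrow>
      (\<forall>t\<in>{1..T}. \<forall>t'\<in>{1..T}. t \<noteq> t' \<longrightarrow>
        (\<forall>i\<in>C t. \<forall>j\<in>C t'.
          \<bar>\<Sum>k\<in>A. S k $ i $ j\<bar>
            \<le> real (card A) * \<mu>1 + real (card A) * (real K - real (card A)) * \<mu>2))"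
    \<comment> \<open>The assumed optimal solution is pinched at one block after another. Pinching
      only sets entries to zero, so the zeros gained at earlier blocks survive.\<close>
    have "n \<le> T \<Longrightarrow> \<exists>\<Theta>. optimal_solution K S \<mu>1 \<mu>2 \<Theta> \<and>
      (\<forall>t\<in>{1..n}. \<forall>i\<in>C t. \<forall>j. j \<notin> C t \<longrightarrow> (\<forall>k. \<Theta> k $ i $ j = 0))" for n
    proof (induction n)
      case 0
      then show ?case using assms(5) by simp
    next
      case (Suc n)
      from Suc.IH[OF Suc_leD[OF Suc.prems]] obtain \<Theta> where opt: "optimal_solution K S \<mu>1 \<mu>2 \<Theta>"
        and zero: "\<And>t i j k. t \<in> {1..n} \<Longrightarrow> i \<in> C t \<Longrightarrow> j \<notin> C t \<Longrightarrow> \<Theta> k $ i $ j = 0"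
        by blast
      have t: "Suc n \<in> {1..T}" using Suc.prems by simp
      let ?\<Psi> = "\<lambda>k. pinch_mat (C (Suc n)) (\<Theta> k)"
      have "optimal_solution K S \<mu>1 \<mu>2 ?\<Psi>"
      proof (rule optimal_solution_pinch_mat[OF opt S])
        fix A i j assume A: "A \<subseteq> {1..K}" "A \<noteq> {}" and i: "i \<in> C (Suc n)" and "j \<notin> C (Suc n)"
        then obtain t' where t': "t' \<in> {1..T}" "Suc n \<noteq> t'" "j \<in> C t'" using cover by blast
        show "\<bar>\<Sum>k\<in>A. S k $ i $ j\<bar>
            \<le> real (card A) * \<mu>1 + real (card A) * (real K - real (card A)) * \<mu>2"
          using cond[rule_format, OF conjI[OF A] t t'(1,2) i t'(3)] .
      qed
      moreover have "?\<Psi> k $ i $ j = 0" if "t \<in> {1..Suc n}" "i \<in> C t" "j \<notin> C t" for t i j k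
        using that zero[of t i j k] by (cases "t = Suc n") (auto simp: pinch_mat_def)
      ultimately show ?case by blast
    qed
    from this[OF order_refl] obtain \<Theta> where opt: "optimal_solution K S \<mu>1 \<mu>2 \<Theta>"
      and zero: "\<And>t i j k. t \<in> {1..T} \<Longrightarrow> i \<in> C t \<Longrightarrow> j \<notin> C t \<Longrightarrow> \<Theta> k $ i $ j = 0"
      by blast
    have "block_diagonal K T C \<Theta>"
      unfolding block_diagonal_def
    proof (intro ballI impI)
      fix t t' i j k
      assume "t \<in> {1..T}" "t' \<in> {1..T}" "t \<noteq> t'" "i \<in> C t" "j \<in> C t'"
      then show "\<Theta> k $ i $ j = 0" using zero[of t i j k] disj[of t t' j] by simp
    qed
    with opt show "\<exists>\<Theta>. optimal_solution K S \<mu>1 \<mu>2 \<Theta> \<and> block_diagonal K T C \<Theta>" by blast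
  qed
qed

end
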